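(* Suppose $A$ and $B$ are real symmetric positive definite $n\times n$ matrices and let $\kappa=\kappa(A^{-1/2}BA^{-1/2})$. Then for $x,y\in\mathbb R^n$ with $x\ne0$ and $y\ne0$, \[ \frac{y^TAx}{\sqrt{x^TAx}\sqrt{y^TAy}}\cdot\frac{y^TBx}{\sqrt{x^TBx}\sqrt{y^TBy}}\ge-\left(\frac{\sqrt\kappa-1}{\sqrt\kappa+1}\right)^2. \]
   Context: The condition number of an invertible matrix $C$ is $\kappa(C)=\|C\|\,\|C^{-1}\|$, where $\|\cdot\|$ denotes the operator norm induced by the Euclidean norm; $A^{-1/2}$ is the inverse of the positive definite square root of $A$. *)

theory Defs
  imports "HOL-Analysis.Analysis"
begin

definition sym_pos_def :: "real ^ 'n ^ 'n \<Rightarrow> bool" where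
  "sym_pos_def A \<longleftrightarrow> transpose A = A \<and> (\<forall>x. x \<noteq> 0 \<longrightarrow> 0 < x \<bullet> (A *v x))"

(* The square root of a symmetric positive definite matrix exists and is unique;
   on other arguments the value is unspecified. *)
definition matrix_sqrt :: "real ^ 'n ^ 'n \<Rightarrow> real ^ 'n ^ 'n" where
  "matrix_sqrt A = (THE S. sym_pos_def S \<and> S ** S = A)"

(* onorm is used because the library's norm on matrices is the Frobenius norm,
   not the operator norm induced by the Euclidean norm. *)
definition cond_number :: "real ^ 'n ^ 'n \<Rightarrow> real" where
  "cond_number C = onorm (\<lambda>x. C *v x) * onorm (\<lambda>x. matrix_inv C *v x)"

end

theory Submission
  imports Defs
begin

text \<open>
  Substituting \<open>w = A\<^sup>1\<^sup>/\<^sup>2 x\<close> turns the form of \<open>A\<close> into the Euclidean one and the form of \<open>B\<close> into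
  that of \<open>C = A\<^sup>-\<^sup>1\<^sup>/\<^sup>2 B A\<^sup>-\<^sup>1\<^sup>/\<^sup>2\<close>. Since \<open>C\<close> is positive definite, its form lies between
  \<open>m = 1 / \<parallel>C\<^sup>-\<^sup>1\<parallel>\<close> and \<open>M = \<parallel>C\<parallel>\<close> times the Euclidean one (\<open>form_lower_bound\<close>,
  \<open>form_upper_bound\<close>; eigenvalues are not needed), so \<open>m A \<le> B \<le> M A\<close> as quadratic forms, and
  \<open>\<kappa> = M / m\<close>.

  Let \<open>c\<close> and \<open>d\<close> be the cosines of the angle between \<open>x\<close> and \<open>y\<close> for \<open>A\<close> and for \<open>B\<close>. Only the case of
  opposite signs matters, and replacing \<open>y\<close> by \<open>- y\<close> gives \<open>c \<ge> 0\<close> and \<open>z = - d \<ge> 0\<close>. The lower bound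
  on \<open>B\<close> at the sum of the \<open>B\<close>-normalised vectors, and the upper bound at the difference of the
  \<open>A\<close>-normalised ones, yield after multiplication
  \<open>m (1 + c) (1 + z) \<le> M (1 - c) (1 - z)\<close> (\<open>opposite_cosines_bound\<close>).
  With \<open>t = \<surd>(c z)\<close> the arithmetic-geometric mean inequality weakens this to
  \<open>m (1 + t)\<^sup>2 \<le> M (1 - t)\<^sup>2\<close>, that is \<open>t \<le> (\<surd>\<kappa> - 1) / (\<surd>\<kappa> + 1)\<close> (\<open>prod_cosines_bound\<close>).

  The square root of \<open>A\<close> exists because, after scaling, \<open>A = 1 - X\<close> with \<open>\<parallel>X\<parallel> < 1\<close>, and
  \<open>Y \<mapsto> (X + Y\<^sup>2) / 2\<close> is a contraction whose fixed point satisfies \<open>(1 - Y)\<^sup>2 = 1 - X\<close>. It is unique by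
  a trace argument.
\<close>

section \<open>Symmetric positive definite matrices\<close>

lemma sym_inner_matrix:
  fixes A :: "real ^ 'n ^ 'n"
  assumes "transpose A = A"
  shows "(A *v u) \<bullet> v = u \<bullet> (A *v v)"
  by (metis assms dot_lmul_matrix transpose_matrix_vector)

lemma form_expand:
  fixes A :: "real ^ 'n ^ 'n"
  assumes "transpose A = A"
  shows "(s *\<^sub>R u + t *\<^sub>R v) \<bullet> (A *v (s *\<^sub>R u + t *\<^sub>R v))
       = s\<^sup>2 * (u \<bullet> (A *v u)) + 2 * s * t * (v \<bullet> (A *v u)) + t\<^sup>2 * (v \<bullet> (A *v v))"
proof -
  have "u \<bullet> (A *v v) = v \<bullet> (A *v u)"
    using sym_inner_matrix[OF assms, of v u] by (simp add: inner_commute)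
  then show ?thesis
    by (simp add: matrix_vector_right_distrib matrix_vector_mult_scaleR inner_add_left
        inner_add_right algebra_simps power2_eq_square)
qed

text \<open>
  The Cauchy-Schwarz inequality for the semi-inner product of a positive semidefinite matrix.
\<close>
lemma form_Cauchy_Schwarz:
  fixes A :: "real ^ 'n ^ 'n"
  assumes sym: "transpose A = A" and psd: "\<And>w. 0 \<le> w \<bullet> (A *v w)"
  shows "(v \<bullet> (A *v u))\<^sup>2 \<le> (u \<bullet> (A *v u)) * (v \<bullet> (A *v v))"
proof -
  let ?a = "u \<bullet> (A *v u)" and ?b = "v \<bullet> (A *v v)" and ?c = "v \<bullet> (A *v u)"
  have quad: "0 \<le> s\<^sup>2 * ?a + 2 * s * t * ?c + t\<^sup>2 * ?b" for s t
    using psd[of "s *\<^sub>R u + t *\<^sub>R v"] form_expand[OF sym, of s u t v] by simp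
  have a0: "0 \<le> ?a" by (rule psd)
  show ?thesis
  proof (cases "?a = 0")
    case True
    have "?c = 0"
    proof (rule ccontr)
      assume c: "?c \<noteq> 0"
      then show False
        \<comment> \<open>For \<open>?a = 0\<close> the form is affine in \<open>s\<close>; here it equals \<open>- 1\<close>.\<close>
        using quad[of "- (?b + 1) / (2 * ?c)" 1] True by (simp add: field_simps)
    qed
    then show ?thesis using True by simp
  next
    case False
    have "0 \<le> ?a * (?a * ?b - ?c\<^sup>2)"
      using quad[of "- ?c" ?a] by (simp add: power2_eq_square algebra_simps)
    with False a0 show ?thesis by (simp add: zero_le_mult_iff)
  qed
qed

lemma sym_pos_def_psd: "sym_pos_def A \<Longrightarrow> 0 \<le> w \<bullet> (A *v w)"
  by (cases "w = 0") (auto simp: sym_pos_def_def less_imp_le)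

lemma sym_pos_def_inverse:
  assumes "sym_pos_def A"
  shows "matrix_inv A ** A = mat 1" "A ** matrix_inv A = mat 1"
proof -
  have "\<forall>x. A *v x = 0 \<longrightarrow> x = 0"
    using assms unfolding sym_pos_def_def by (metis inner_zero_right less_irrefl)
  then have "invertible A"
    using matrix_left_invertible_ker invertible_left_inverse by blast
  then have "\<exists>A'. A ** A' = mat 1 \<and> A' ** A = mat 1"
    by (simp add: invertible_def)
  then have "A ** matrix_inv A = mat 1 \<and> matrix_inv A ** A = mat 1"
    unfolding matrix_inv_def by (rule someI_ex)
  then show "matrix_inv A ** A = mat 1" "A ** matrix_inv A = mat 1"
    by simp_all
qed

lemma form_upper_bound:
  fixes A :: "real ^ 'n ^ 'n"
  shows "w \<bullet> (A *v w) \<le> onorm ((*v) A) * (w \<bullet> w)"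
proof -
  have "w \<bullet> (A *v w) \<le> norm w * norm (A *v w)" by (rule norm_cauchy_schwarz)
  also have "\<dots> \<le> norm w * (onorm ((*v) A) * norm w)"
    by (intro mult_left_mono onorm matrix_vector_mul_bounded_linear norm_ge_zero)
  finally show ?thesis by (simp add: dot_square_norm power2_eq_square algebra_simps)
qed

text \<open>
  The smallest eigenvalue of \<open>A\<close> is \<open>1 / \<parallel>A\<^sup>-\<^sup>1\<parallel>\<close>. The bound follows from Cauchy-Schwarz for the
  form of \<open>A\<close>, applied to \<open>w\<close> and \<open>A\<^sup>-\<^sup>1 w\<close>.
\<close>
lemma form_lower_bound:
  fixes A :: "real ^ 'n ^ 'n"
  assumes "sym_pos_def A"
  shows "w \<bullet> w \<le> onorm ((*v) (matrix_inv A)) * (w \<bullet> (A *v w))"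
proof (cases "w = 0")
  case False
  let ?u = "matrix_inv A *v w"
  have Au: "A *v ?u = w"
    by (simp add: matrix_vector_mul_assoc sym_pos_def_inverse[OF assms])
  have "(w \<bullet> (A *v ?u))\<^sup>2 \<le> (?u \<bullet> (A *v ?u)) * (w \<bullet> (A *v w))"
    using assms by (intro form_Cauchy_Schwarz) (auto simp: sym_pos_def_psd sym_pos_def_def)
  also have "\<dots> \<le> (onorm ((*v) (matrix_inv A)) * (w \<bullet> w)) * (w \<bullet> (A *v w))"
    using form_upper_bound[of w "matrix_inv A"] sym_pos_def_psd[OF assms, of w]
    by (intro mult_right_mono) (auto simp: Au inner_commute)
  finally show ?thesis using False
    by (simp add: Au power2_eq_square mult.assoc mult.left_commute)
qed (simp)

text \<open>
  For a positive semidefinite matrix a bound on the quadratic form bounds the operator norm.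
\<close>
lemma psd_norm_bound:
  fixes A :: "real ^ 'n ^ 'n"
  assumes sym: "transpose A = A" and psd: "\<And>w. 0 \<le> w \<bullet> (A *v w)"
    and ub: "\<And>w. w \<bullet> (A *v w) \<le> q * (w \<bullet> w)" and q: "0 \<le> q"
  shows "norm (A *v u) \<le> q * norm u"
proof (cases "A *v u = 0")
  case False
  let ?v = "A *v u"
  have "(?v \<bullet> ?v)\<^sup>2 \<le> (u \<bullet> (A *v u)) * (?v \<bullet> (A *v ?v))"
    by (rule form_Cauchy_Schwarz[OF sym psd])
  also have "\<dots> \<le> (q * (u \<bullet> u)) * (q * (?v \<bullet> ?v))"
    using psd q by (intro mult_mono ub) auto
  finally have "(?v \<bullet> ?v) * (?v \<bullet> ?v) \<le> (q\<^sup>2 * (u \<bullet> u)) * (?v \<bullet> ?v)"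
    by (simp add: power2_eq_square algebra_simps)
  then have "?v \<bullet> ?v \<le> q\<^sup>2 * (u \<bullet> u)"
    using False by (simp only: mult_le_cancel_right) (simp add: not_less)
  then have "(norm ?v)\<^sup>2 \<le> (q * norm u)\<^sup>2"
    by (simp add: dot_square_norm power_mult_distrib)
  then show ?thesis by (rule power2_le_imp_le) (use q in simp)
qed (use q in simp)

lemma onorm_sym_pos_def_pos:
  fixes A :: "real ^ 'n ^ 'n"
  assumes "sym_pos_def A"
  shows "0 < onorm ((*v) A)" "0 < onorm ((*v) (matrix_inv A))"
proof -
  define w :: "real ^ 'n" where "w = axis undefined 1"
  have w: "w \<noteq> 0" by (simp add: w_def axis_eq_0_iff)
  then have p: "0 < w \<bullet> (A *v w)" using assms by (simp add: sym_pos_def_def)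
  have "0 < onorm ((*v) A) * (w \<bullet> w)" using p form_upper_bound[of w A] by linarith
  then show "0 < onorm ((*v) A)"
    using zero_less_mult_pos2 w inner_gt_zero_iff by blast
  have "0 < w \<bullet> w" using w by simp
  also note form_lower_bound[OF assms, of w]
  finally show "0 < onorm ((*v) (matrix_inv A))" using p by (simp add: zero_less_mult_iff)
qed

section \<open>The positive definite square root\<close>

lemma trace_conjugate:
  fixes D S :: "real ^ 'n ^ 'n"
  assumes "transpose D = D"
  shows "trace (D ** (S ** D)) = (\<Sum>i\<in>UNIV. (D *v axis i 1) \<bullet> (S *v (D *v axis i 1)))"
proof -
  have "(D ** (S ** D)) $ i $ i = axis i 1 \<bullet> ((D ** (S ** D)) *v axis i 1)" for i
    by (simp add: inner_axis' matrix_vector_mult_basis column_def)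
  also have "axis i 1 \<bullet> ((D ** (S ** D)) *v axis i 1)
      = (D *v axis i 1) \<bullet> (S *v (D *v axis i 1))" for i
    by (simp add: sym_inner_matrix[OF assms] matrix_vector_mul_assoc matrix_mul_assoc)
  finally show ?thesis by (simp add: trace_def)
qed

text \<open>
  With \<open>D = S - T\<close>, equality of the squares gives \<open>S D + D T = 0\<close>. Multiplying by \<open>D\<close> and taking
  traces, \<open>tr (D S D) + tr (D T D) = 0\<close>; both traces are sums of values of the positive definite forms
  of \<open>S\<close> and \<open>T\<close> at the columns of \<open>D\<close>, so \<open>D = 0\<close>.
\<close>
lemma sym_pos_def_sqrt_unique:
  fixes S T :: "real ^ 'n ^ 'n"
  assumes S: "sym_pos_def S" and T: "sym_pos_def T" and eq: "S ** S = T ** T"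
  shows "S = T"
proof -
  define D where "D = S - T"
  have symD: "transpose D = D"
    using S T by (simp add: D_def sym_pos_def_def transpose_def vec_eq_iff)
  have "(S ** D + D ** T) *v u = 0 *v u" for u
  proof -
    have "S *v (S *v u) = T *v (T *v u)" by (simp add: matrix_vector_mul_assoc eq)
    then show ?thesis
      by (simp add: D_def matrix_vector_mult_add_rdistrib matrix_vector_mult_diff_rdistrib
          matrix_vector_mult_diff_distrib matrix_vector_mul_assoc[symmetric])
  qed
  then have "S ** D + D ** T = 0" using matrix_eq by blast
  then have "D ** (S ** D) + D ** (D ** T) = 0"
    by (simp flip: matrix_add_ldistrib)
  then have "trace (D ** (S ** D)) + trace (D ** (D ** T)) = 0"
    by (simp flip: trace_add) (simp add: trace_def)
  moreover have "trace (D ** (D ** T)) = trace (D ** (T ** D))"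
    using trace_mul_sym[of D "D ** T"] by (simp add: matrix_mul_assoc)
  ultimately have sum0: "(\<Sum>i\<in>UNIV. (D *v axis i 1) \<bullet> (S *v (D *v axis i 1))
      + (D *v axis i 1) \<bullet> (T *v (D *v axis i 1))) = 0"
    by (simp add: trace_conjugate[OF symD] sum.distrib)
  have "D *v axis i 1 = 0" for i
  proof -
    have "(D *v axis i 1) \<bullet> (S *v (D *v axis i 1)) + (D *v axis i 1) \<bullet> (T *v (D *v axis i 1)) = 0"
      using sum0 sym_pos_def_psd[OF S] sym_pos_def_psd[OF T]
      by (subst (asm) sum_nonneg_eq_0_iff) (auto intro: add_nonneg_nonneg)
    then show ?thesis
      using S sym_pos_def_psd[OF T, of "D *v axis i 1"] unfolding sym_pos_def_def
      by (metis add_pos_nonneg less_irrefl)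
  qed
  then have "D = 0"
    by (simp add: matrix_vector_mult_basis column_def vec_eq_iff)
  then show ?thesis by (simp add: D_def)
qed

text \<open>
  The equation for \<open>Y\<close> says \<open>(1 - Y)\<^sup>2 = 1 - X\<close>. Bounded linear functions are used instead of
  matrices because their norm is the operator norm, for which the map
  \<open>Y \<mapsto> (X + Y\<^sup>2) / 2\<close> is a contraction with factor \<open>q\<close> of the self-adjoint part of the \<open>q\<close>-ball.
\<close>
lemma self_adjoint_sqrt_one_minus:
  fixes X :: "'a::euclidean_space \<Rightarrow>\<^sub>L 'a"
  assumes sym: "\<And>u v. blinfun_apply X u \<bullet> v = u \<bullet> blinfun_apply X v" and q: "norm X \<le> q" "q < 1"
  shows "\<exists>Y :: 'a \<Rightarrow>\<^sub>L 'a. (\<forall>u v. blinfun_apply Y u \<bullet> v = u \<bullet> blinfun_apply Y v) \<and> norm Y \<le> q \<and>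
           2 *\<^sub>R Y = X + (Y o\<^sub>L Y)"
proof -
  define K where "K = {Y :: 'a \<Rightarrow>\<^sub>L 'a. (\<forall>u v. blinfun_apply Y u \<bullet> v = u \<bullet> blinfun_apply Y v) \<and> norm Y \<le> q}"
  define f where "f Y = (1/2) *\<^sub>R (X + (Y o\<^sub>L Y))" for Y :: "'a \<Rightarrow>\<^sub>L 'a"
  have q0: "0 \<le> q" using q(1) norm_ge_zero order_trans by blast
  have "closed K" unfolding K_def
    by (intro closed_Collect_conj closed_Collect_all closed_Collect_eq closed_Collect_le
        continuous_intros)
  then have "complete K" by (simp add: complete_eq_closed)
  moreover have "K \<noteq> {}" using q0 by (auto simp: K_def intro: exI[of _ 0])
  moreover have "f ` K \<subseteq> K"
  proof
    fix Z assume "Z \<in> f ` K"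
    then obtain Y where Y: "Y \<in> K" and Z: "Z = f Y" by auto
    have "norm (Y o\<^sub>L Y) \<le> norm Y * norm Y" by (rule norm_blinfun_compose)
    also have "\<dots> \<le> q * 1" using Y q q0 by (intro mult_mono) (auto simp: K_def)
    finally have "norm (X + (Y o\<^sub>L Y)) \<le> 2 * q"
      using norm_triangle_ineq[of X "Y o\<^sub>L Y"] q by linarith
    then show "Z \<in> K"
      using Y sym unfolding K_def Z f_def
      by (auto simp: blinfun.bilinear_simps inner_add_left inner_add_right)
  qed
  moreover have "dist (f Y) (f Z) \<le> q * dist Y Z"
    if YZ: "Y \<in> K" "Z \<in> K" for Y Z
  proof -
    have "f Y - f Z = (1/2) *\<^sub>R ((Y o\<^sub>L (Y - Z)) + ((Y - Z) o\<^sub>L Z))"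
      unfolding f_def by (rule blinfun_eqI) (simp add: blinfun.bilinear_simps scaleR_diff_right[symmetric])
    then have "dist (f Y) (f Z) = norm ((Y o\<^sub>L (Y - Z)) + ((Y - Z) o\<^sub>L Z)) / 2"
      by (simp add: dist_norm)
    also have "\<dots> \<le> (norm Y * norm (Y - Z) + norm (Y - Z) * norm Z) / 2"
      by (intro divide_right_mono norm_triangle_le add_mono norm_blinfun_compose) simp
    also have "\<dots> \<le> (q * norm (Y - Z) + norm (Y - Z) * q) / 2"
      using YZ by (intro divide_right_mono add_mono mult_right_mono mult_left_mono)
        (auto simp: K_def)
    finally show "dist (f Y) (f Z) \<le> q * dist Y Z" by (simp add: dist_norm)
  qed
  ultimately obtain Y where Y: "Y \<in> K" "f Y = Y"
    using Banach_fix[of K q f] q0 q(2) by metis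
  have "2 *\<^sub>R f Y = X + (Y o\<^sub>L Y)" by (simp add: f_def)
  then show ?thesis using Y unfolding K_def by auto
qed

text \<open>
  Here \<open>X = 1 - A / \<beta>\<close> with \<open>\<beta> = \<parallel>A\<parallel>\<close>, whose form lies between \<open>0\<close> and \<open>q = 1 - 1 / (\<parallel>A\<parallel> \<parallel>A\<^sup>-\<^sup>1\<parallel>)\<close>
  times the Euclidean one. The root is \<open>\<surd>\<beta> (1 - Y)\<close>, positive definite since \<open>\<parallel>Y\<parallel> \<le> q < 1\<close>.
\<close>
lemma sym_pos_def_sqrt_exists:
  fixes A :: "real ^ 'n ^ 'n"
  assumes A: "sym_pos_def A"
  shows "\<exists>S. sym_pos_def S \<and> S ** S = A"
proof -
  define \<beta> where "\<beta> = onorm ((*v) A)"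
  define N where "N = onorm ((*v) (matrix_inv A))"
  define q where "q = 1 - 1 / (\<beta> * N)"
  define M where "M = mat 1 - (1 / \<beta>) *\<^sub>R A"
  have \<beta>: "0 < \<beta>" and N: "0 < N"
    using onorm_sym_pos_def_pos[OF A] by (simp_all add: \<beta>_def N_def)
  have Mv: "M *v u = u - (1 / \<beta>) *\<^sub>R (A *v u)" for u
    by (simp add: M_def matrix_vector_mult_diff_rdistrib scaleR_matrix_vector_assoc)
  have symM: "transpose M = M"
    using A by (simp add: M_def sym_pos_def_def transpose_def vec_eq_iff mat_def)
  have form: "w \<bullet> (M *v w) = w \<bullet> w - (w \<bullet> (A *v w)) / \<beta>" for w
    by (simp add: Mv inner_diff_right)
  have psd: "0 \<le> w \<bullet> (M *v w)" for w
    using form_upper_bound[of w A] \<beta> by (simp add: form \<beta>_def[symmetric] field_simps)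
  have ub: "w \<bullet> (M *v w) \<le> q * (w \<bullet> w)" for w
    using form_lower_bound[OF A, of w] \<beta> N
    by (simp add: form q_def N_def[symmetric] field_simps)
  define e :: "real ^ 'n" where "e = axis undefined 1"
  have "0 < e \<bullet> e" by (simp add: e_def axis_eq_0_iff)
  moreover have "0 \<le> q * (e \<bullet> e)" using psd[of e] ub[of e] by linarith
  ultimately have q0: "0 \<le> q" using zero_le_mult_iff[of q "e \<bullet> e"] by linarith
  have q1: "q < 1" using \<beta> N by (simp add: q_def)
  define X where "X = Blinfun ((*v) M)"
  have X: "blinfun_apply X = (*v) M"
    unfolding X_def by (intro bounded_linear_Blinfun_apply matrix_vector_mul_bounded_linear)
  have "norm X \<le> q"
    using q0 psd_norm_bound[OF symM psd ub q0] by (intro norm_blinfun_bound) (auto simp: X)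
  moreover have "blinfun_apply X u \<bullet> v = u \<bullet> blinfun_apply X v" for u v
    by (simp add: X sym_inner_matrix[OF symM])
  ultimately obtain Y :: "(real ^ 'n) \<Rightarrow>\<^sub>L (real ^ 'n)"
    where symY: "\<And>u v. blinfun_apply Y u \<bullet> v = u \<bullet> blinfun_apply Y v"
      and Yq: "norm Y \<le> q" and Yeq: "2 *\<^sub>R Y = X + (Y o\<^sub>L Y)"
    using self_adjoint_sqrt_one_minus[of X q] q1 by blast
  have matY: "matrix (blinfun_apply Y) *v u = Y u" for u
    using matrix_vector_mul(3)[OF blinfun.bounded_linear_right[of Y]] by (rule fun_cong)
  define S where "S = sqrt \<beta> *\<^sub>R (mat 1 - matrix (blinfun_apply Y))"
  have Sv: "S *v u = sqrt \<beta> *\<^sub>R (u - blinfun_apply Y u)" for u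
    by (simp add: S_def matY matrix_vector_mult_diff_rdistrib flip: scaleR_matrix_vector_assoc)
  have "(S ** S) *v u = A *v u" for u
  proof -
    have "2 *\<^sub>R blinfun_apply Y u = X u + Y (Y u)"
      using arg_cong[OF Yeq, of "\<lambda>Z. blinfun_apply Z u"] by (simp add: blinfun.bilinear_simps)
    then have YY: "Y (Y u) = 2 *\<^sub>R Y u - u + (1 / \<beta>) *\<^sub>R (A *v u)"
      by (simp add: X Mv algebra_simps)
    have "(S ** S) *v u = \<beta> *\<^sub>R (u - Y u - Y (u - Y u))"
      using \<beta> by (simp add: matrix_vector_mul_assoc[symmetric] Sv blinfun.bilinear_simps
          scaleR_diff_right[symmetric])
    also have "u - Y u - Y (u - Y u) = (1 / \<beta>) *\<^sub>R (A *v u)"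
      by (simp add: blinfun.bilinear_simps YY scaleR_2)
    finally show ?thesis using \<beta> by simp
  qed
  then have SS: "S ** S = A" by (simp add: matrix_eq)
  have "u \<bullet> (transpose S *v v) = u \<bullet> (S *v v)" for u v
  proof -
    have "u \<bullet> (transpose S *v v) = (S *v u) \<bullet> v"
      by (metis dot_lmul_matrix inner_commute transpose_matrix_vector)
    also have "\<dots> = u \<bullet> (S *v v)" by (simp add: Sv inner_diff_left inner_diff_right symY)
    finally show ?thesis .
  qed
  then have "transpose S = S" by (metis matrix_eq vector_eq_ldot)
  moreover have "0 < u \<bullet> (S *v u)" if "u \<noteq> 0" for u
  proof -
    have "u \<bullet> Y u \<le> norm u * norm (Y u)" by (rule norm_cauchy_schwarz)
    also have "\<dots> \<le> norm u * (q * norm u)"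
      using norm_blinfun[of Y u] mult_right_mono[OF Yq, of "norm u"]
      by (intro mult_left_mono) auto
    also have "\<dots> < norm u * (1 * norm u)" using that q1 by simp
    finally show ?thesis
      using \<beta> by (simp add: Sv inner_diff_right dot_square_norm power2_eq_square)
  qed
  ultimately show ?thesis using SS unfolding sym_pos_def_def by blast
qed

lemma matrix_sqrt_sym_pos_def:
  assumes "sym_pos_def A"
  shows "sym_pos_def (matrix_sqrt A)" "matrix_sqrt A ** matrix_sqrt A = A"
proof -
  have "\<exists>!S. sym_pos_def S \<and> S ** S = A"
    using sym_pos_def_sqrt_exists[OF assms] sym_pos_def_sqrt_unique by metis
  then have "sym_pos_def (matrix_sqrt A) \<and> matrix_sqrt A ** matrix_sqrt A = A"
    unfolding matrix_sqrt_def by (rule theI')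
  then show "sym_pos_def (matrix_sqrt A)" "matrix_sqrt A ** matrix_sqrt A = A" by auto
qed

section \<open>The cosines of one pair of vectors in two inner products\<close>

lemma prod_cosines_bound:
  fixes c z m M :: real
  assumes c: "0 \<le> c" "c \<le> 1" and z: "0 \<le> z" "z \<le> 1" and m: "0 < m"
    and le: "m * ((1 + c) * (1 + z)) \<le> M * ((1 - c) * (1 - z))"
  shows "c * z \<le> ((sqrt (M / m) - 1) / (sqrt (M / m) + 1))\<^sup>2"
proof -
  define t where "t = sqrt (c * z)"
  have tt: "t\<^sup>2 = c * z" and t0: "0 \<le> t" using c z by (simp_all add: t_def)
  have t1: "t \<le> 1" using c z by (simp add: t_def mult_le_one)
  have amgm: "2 * t \<le> c + z"
    using arith_geo_mean_sqrt[OF c(1) z(1)] by (simp add: t_def)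
  have "0 < m * ((1 + c) * (1 + z))" using c z m by simp
  then have M: "0 < M"
    using le c z by (meson diff_ge_0_iff_ge less_le_trans mult_nonneg_nonneg zero_less_mult_pos2
        mult_nonpos_nonneg not_le less_imp_le)
  have "m * (1 + t)\<^sup>2 \<le> m * ((1 + c) * (1 + z))"
    using m amgm tt by (intro mult_left_mono) (auto simp: power2_eq_square algebra_simps)
  also note le
  also have "M * ((1 - c) * (1 - z)) \<le> M * (1 - t)\<^sup>2"
    using M amgm tt by (intro mult_left_mono) (auto simp: power2_eq_square algebra_simps)
  finally have "(1 + t)\<^sup>2 \<le> M / m * (1 - t)\<^sup>2"
    using m by (simp add: field_simps)
  then have "sqrt ((1 + t)\<^sup>2) \<le> sqrt (M / m * (1 - t)\<^sup>2)" by (rule real_sqrt_le_mono)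
  then have k: "1 + t \<le> sqrt (M / m) * (1 - t)"
    using t0 t1 by (simp only: real_sqrt_mult real_sqrt_abs abs_of_nonneg)
  have "0 < sqrt (M / m) + 1" using m M by (simp add: add_nonneg_pos)
  then have "t \<le> (sqrt (M / m) - 1) / (sqrt (M / m) + 1)"
    using k by (simp add: pos_le_divide_eq algebra_simps)
  then have "t\<^sup>2 \<le> ((sqrt (M / m) - 1) / (sqrt (M / m) + 1))\<^sup>2"
    using t0 by (rule power_mono)
  then show ?thesis by (simp add: tt)
qed

text \<open>
  The case of the theorem in which the cosine \<open>c\<close> for \<open>A\<close> is nonnegative and the cosine \<open>d\<close> for \<open>B\<close> is
  nonpositive, with the spectral condition stated as \<open>m A \<le> B \<le> M A\<close>.
\<close>
lemma opposite_cosines_bound: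
  fixes A B :: "real ^ 'n ^ 'n" and x y :: "real ^ 'n"
  assumes A: "sym_pos_def A" and B: "sym_pos_def B" and m: "0 < m"
    and lo: "\<And>w. m * (w \<bullet> (A *v w)) \<le> w \<bullet> (B *v w)"
    and hi: "\<And>w. w \<bullet> (B *v w) \<le> M * (w \<bullet> (A *v w))"
    and x: "x \<noteq> 0" and y: "y \<noteq> 0"
    and c_def: "c = (y \<bullet> (A *v x)) / (sqrt (x \<bullet> (A *v x)) * sqrt (y \<bullet> (A *v y)))"
    and d_def: "d = (y \<bullet> (B *v x)) / (sqrt (x \<bullet> (B *v x)) * sqrt (y \<bullet> (B *v y)))"
    and c: "0 \<le> c" and d: "d \<le> 0"
  shows "- (((sqrt (M / m) - 1) / (sqrt (M / m) + 1))\<^sup>2) \<le> c * d"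
proof -
  define a where "a = sqrt (x \<bullet> (A *v x))"
  define b where "b = sqrt (y \<bullet> (A *v y))"
  define p where "p = sqrt (x \<bullet> (B *v x))"
  define r where "r = sqrt (y \<bullet> (B *v y))"
  have pos: "0 < a" "0 < b" "0 < p" "0 < r"
    using A B x y by (simp_all add: a_def b_def p_def r_def sym_pos_def_def)
  have xx: "x \<bullet> (A *v x) = a\<^sup>2" "y \<bullet> (A *v y) = b\<^sup>2" "x \<bullet> (B *v x) = p\<^sup>2" "y \<bullet> (B *v y) = r\<^sup>2"
    using sym_pos_def_psd[OF A] sym_pos_def_psd[OF B] by (simp_all add: a_def b_def p_def r_def)
  have yx: "y \<bullet> (A *v x) = c * (a * b)" "y \<bullet> (B *v x) = d * (p * r)"
    using pos by (simp_all add: c_def d_def a_def b_def p_def r_def)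
  have formA: "(s *\<^sub>R x + t *\<^sub>R y) \<bullet> (A *v (s *\<^sub>R x + t *\<^sub>R y))
      = (s * a)\<^sup>2 + 2 * c * (s * a) * (t * b) + (t * b)\<^sup>2" for s t
    using A by (simp add: form_expand sym_pos_def_def xx yx power_mult_distrib)
  have formB: "(s *\<^sub>R x + t *\<^sub>R y) \<bullet> (B *v (s *\<^sub>R x + t *\<^sub>R y))
      = (s * p)\<^sup>2 + 2 * d * (s * p) * (t * r) + (t * r)\<^sup>2" for s t
    using B by (simp add: form_expand sym_pos_def_def xx yx power_mult_distrib)
  define h where "h = (a * b) / (p * r)"
  have h: "0 < h" using pos by (simp add: h_def)
  have amgm: "2 * (u * v) \<le> u\<^sup>2 + v\<^sup>2" for u v :: real
    using sum_squares_bound[of u v] by simp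
  \<comment> \<open>Lower bound at the sum of the \<open>B\<close>-normalised vectors \<open>x / p\<close> and \<open>y / r\<close>.\<close>
  have "m * (2 * h * (1 + c)) \<le> m * ((a / p)\<^sup>2 + 2 * c * (a / p) * (b / r) + (b / r)\<^sup>2)"
  proof (rule mult_left_mono)
    have "(a / p) * (b / r) = h" "2 * c * (a / p) * (b / r) = 2 * (h * c)"
      by (simp_all add: h_def)
    then show "2 * h * (1 + c) \<le> (a / p)\<^sup>2 + 2 * c * (a / p) * (b / r) + (b / r)\<^sup>2"
      using amgm[of "a / p" "b / r"] by (simp only: distrib_left)
  qed (use m in simp)
  also have "\<dots> \<le> 2 * (1 + d)"
    using lo[of "(1 / p) *\<^sub>R x + (1 / r) *\<^sub>R y"] pos unfolding formA formB by simp
  finally have one: "m * (1 + c) * h \<le> 1 + d" by (simp add: algebra_simps)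
  \<comment> \<open>Upper bound at the difference of the \<open>A\<close>-normalised vectors \<open>x / a\<close> and \<open>y / b\<close>.\<close>
  have "2 * (1 - d) / h \<le> (p / a)\<^sup>2 - 2 * d * (p / a) * (r / b) + (r / b)\<^sup>2"
  proof -
    have "(p / a) * (r / b) = 1 / h" "2 * d * (p / a) * (r / b) = 2 * d / h"
      by (simp_all add: h_def)
    then show ?thesis
      using amgm[of "p / a" "r / b"] by (simp add: right_diff_distrib diff_divide_distrib
          del: times_divide_eq_left times_divide_eq_right times_divide_times_eq)
  qed
  also have "\<dots> \<le> M * (2 * (1 - c))"
    using hi[of "(1 / a) *\<^sub>R x + (- 1 / b) *\<^sub>R y"] pos unfolding formA formB by simp
  finally have two: "1 - d \<le> M * (1 - c) * h" using h by (simp add: field_simps)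
  have d1: "- d \<le> 1" using one m c h by (smt (verit) mult_nonneg_nonneg)
  \<comment> \<open>The unknown ratio \<open>h\<close> occurs on both sides of the product of the two bounds and cancels.\<close>
  have "(m * (1 + c) * h) * (1 - d) \<le> (1 + d) * (M * (1 - c) * h)"
    using one two m c d d1 h by (intro mult_mono) auto
  then have le: "m * ((1 + c) * (1 + (- d))) \<le> M * ((1 - c) * (1 - (- d)))"
    using h by (simp add: mult.assoc mult.left_commute mult.commute)
  have "(y \<bullet> (A *v x))\<^sup>2 \<le> (x \<bullet> (A *v x)) * (y \<bullet> (A *v y))"
    using A by (intro form_Cauchy_Schwarz) (auto simp: sym_pos_def_psd sym_pos_def_def)
  then have "c\<^sup>2 * (a * b)\<^sup>2 \<le> 1 * (a * b)\<^sup>2" by (simp add: xx yx power_mult_distrib)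
  then have "c\<^sup>2 \<le> 1" using pos by (simp only: mult_le_cancel_right) auto
  then have "c \<le> 1" by (simp add: abs_square_le_1)
  from prod_cosines_bound[OF c this _ d1 m le] d show ?thesis by simp
qed

lemma cosine_product_bound:
  fixes A B :: "real ^ 'n ^ 'n" and x y :: "real ^ 'n"
  assumes A: "sym_pos_def A" and B: "sym_pos_def B" and m: "0 < m"
    and lo: "\<And>w. m * (w \<bullet> (A *v w)) \<le> w \<bullet> (B *v w)"
    and hi: "\<And>w. w \<bullet> (B *v w) \<le> M * (w \<bullet> (A *v w))"
    and x: "x \<noteq> 0" and y: "y \<noteq> 0"
  shows "- (((sqrt (M / m) - 1) / (sqrt (M / m) + 1))\<^sup>2)
    \<le> (y \<bullet> (A *v x)) / (sqrt (x \<bullet> (A *v x)) * sqrt (y \<bullet> (A *v y)))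
      * ((y \<bullet> (B *v x)) / (sqrt (x \<bullet> (B *v x)) * sqrt (y \<bullet> (B *v y))))"
    (is "?K \<le> ?c * ?d")
proof -
  consider "0 \<le> ?c * ?d" | "0 \<le> ?c" "?d \<le> 0" | "?c \<le> 0" "0 \<le> ?d"
    by (metis linear mult_nonneg_nonneg mult_nonpos_nonpos)
  then show ?thesis
  proof cases
    case 1
    have "?K \<le> 0" by simp
    with 1 show ?thesis by (rule order_trans[rotated])
  next
    case 2
    from opposite_cosines_bound[OF A B m lo hi x y refl refl 2] show ?thesis .
  next
    case 3
    have neg: "(- y) \<bullet> v = - (y \<bullet> v)" "C *v (- y) = - (C *v y)" for v and C :: "real ^ 'n ^ 'n"
      using matrix_vector_mult_scaleR[of C "-1" y] by simp_all
    have "- y \<noteq> 0" using y by simp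
    from opposite_cosines_bound[OF A B m lo hi x this refl refl] 3
    show ?thesis unfolding neg by simp
  qed
qed

theorem lemma3p6:
  fixes A B :: "real ^ 'n ^ 'n" and x y :: "real ^ 'n" and \<kappa> :: real
  assumes "sym_pos_def A" and "sym_pos_def B"
    and "\<kappa> = cond_number (matrix_inv (matrix_sqrt A) ** B ** matrix_inv (matrix_sqrt A))"
    and "x \<noteq> 0" and "y \<noteq> 0"
  shows "(y \<bullet> (A *v x)) / (sqrt (x \<bullet> (A *v x)) * sqrt (y \<bullet> (A *v y)))
       * ((y \<bullet> (B *v x)) / (sqrt (x \<bullet> (B *v x)) * sqrt (y \<bullet> (B *v y))))
       \<ge> - (((sqrt \<kappa> - 1) / (sqrt \<kappa> + 1)) ^ 2)"
proof -
  define S where "S = matrix_sqrt A"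
  define R where "R = matrix_inv S"
  define C where "C = R ** B ** R"
  have S: "sym_pos_def S" "S ** S = A" using matrix_sqrt_sym_pos_def[OF assms(1)] by (auto simp: S_def)
  have RS: "R ** S = mat 1" "S ** R = mat 1"
    using sym_pos_def_inverse[OF S(1)] by (simp_all add: R_def)
  have symS: "transpose S = S" using S(1) by (simp add: sym_pos_def_def)
  have "transpose R ** S = mat 1"
    using arg_cong[OF RS(2), of transpose] by (simp add: matrix_transpose_mul symS transpose_mat)
  then have symR: "transpose R = R"
    by (metis RS(2) matrix_mul_assoc matrix_mul_lid matrix_mul_rid)
  have Cform: "w \<bullet> (C *v w) = (R *v w) \<bullet> (B *v (R *v w))" for w
    by (simp add: C_def sym_inner_matrix[OF symR] matrix_vector_mul_assoc matrix_mul_assoc)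
  have C: "sym_pos_def C"
    unfolding sym_pos_def_def
  proof (intro conjI allI impI)
    show "transpose C = C"
      using assms(2) by (simp add: C_def matrix_transpose_mul symR sym_pos_def_def matrix_mul_assoc)
  next
    fix w :: "real ^ 'n" assume "w \<noteq> 0"
    moreover have "S *v (R *v w) = w" by (simp add: matrix_vector_mul_assoc RS)
    ultimately have "R *v w \<noteq> 0" by (metis matrix_vector_mult_0_right)
    then show "0 < w \<bullet> (C *v w)"
      using assms(2) by (simp add: Cform sym_pos_def_def)
  qed
  have Aform: "w \<bullet> (A *v w) = (S *v w) \<bullet> (S *v w)" for w
    by (simp add: sym_inner_matrix[OF symS] matrix_vector_mul_assoc S(2))
  have Bform: "w \<bullet> (B *v w) = (S *v w) \<bullet> (C *v (S *v w))" for w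
  proof -
    have "R *v (S *v w) = w" by (simp add: matrix_vector_mul_assoc RS)
    then show ?thesis by (simp add: Cform)
  qed
  define M where "M = onorm ((*v) C)"
  define N where "N = onorm ((*v) (matrix_inv C))"
  have N: "0 < N" using onorm_sym_pos_def_pos[OF C] by (simp add: N_def)
  have lo: "(1 / N) * (w \<bullet> (A *v w)) \<le> w \<bullet> (B *v w)" for w
    using form_lower_bound[OF C, of "S *v w"] N
    unfolding Aform Bform by (simp add: N_def[symmetric] field_simps)
  have hi: "w \<bullet> (B *v w) \<le> M * (w \<bullet> (A *v w))" for w
    using form_upper_bound[of "S *v w" C] unfolding Aform Bform M_def .
  have \<kappa>: "\<kappa> = M / (1 / N)"
    by (simp add: assms(3) cond_number_def M_def N_def C_def R_def S_def)
  have "0 < 1 / N" using N by simp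
  from cosine_product_bound[OF assms(1,2) this lo hi assms(4,5)]
  show ?thesis unfolding \<kappa> .
qed

end
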